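(* Given integers $j \geq 0$, $n \geq 1$, and $s \geq 2$ such that $j < s$ and $(s-1)n \geq 2$, we have that $$\sum_{v=0}^{\lfloor (n-j)/s \rfloor} \binom{n}{vs+j} = \left\lfloor \frac{(2^n+1)^n \bmod (2^{ns}-1)}{2^{nj}} \right\rfloor \bmod 2^n.$$
   Context: For an integer $a$ and a positive integer $b$, $a \bmod b$ denotes the remainder $a - b\lfloor a/b \rfloor \in \{0, \ldots, b-1\}$. A sum whose upper limit is negative (which occurs when $j > n$) is empty and equal to $0$. *)

theory Defs
  imports Complex_Main
begin

end

theory Submission
  imports Defs
begin

text \<open>
  Put \<open>x = 2\<^sup>n\<close>. Reducing exponents modulo \<open>s\<close> in the binomial expansion of \<open>(x + 1)\<^sup>n\<close> gives
  \<open>(x + 1)\<^sup>n \<equiv> \<Sum>j<s. c\<^sub>j x\<^sup>j\<close> modulo \<open>x\<^sup>s - 1\<close>, where \<open>c\<^sub>j\<close> is the sum of the binomial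
  coefficients with lower index congruent to \<open>j\<close>. The \<open>c\<^sub>j\<close> add up to \<open>x\<close> and at least two
  of them are positive, so each is a base-\<open>x\<close> digit; as \<open>x < s (x - 1)\<close>, not all of them equal
  \<open>x - 1\<close>. Hence the sum is the remainder itself and the \<open>c\<^sub>j\<close> are its base-\<open>x\<close> digits.
\<close>

text \<open>Induction on \<open>s\<close> peels off the lowest digit: since
  \<open>0 \<le> c 0 < x\<close>, division by \<open>x\<close> discards \<open>c 0\<close> and
  shifts the other digits down by one place.\<close>

lemma div_power_mod_digit_sum:
  fixes c :: "nat \<Rightarrow> int"
  assumes "\<And>i. i < s \<Longrightarrow> 0 \<le> c i \<and> c i < x" and "j < s"
  shows "(\<Sum>i<s. c i * x ^ i) div x ^ j mod x = c j"
  using assms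
proof (induction s arbitrary: c j)
  case 0
  then show ?case by simp
next
  case (Suc s)
  have c0: "0 \<le> c 0" "c 0 < x" using Suc.prems(1)[of 0] by auto
  define r where "r = (\<Sum>i<s. c (Suc i) * x ^ i)"
  have eq: "(\<Sum>i<Suc s. c i * x ^ i) = c 0 + x * r"
    unfolding r_def by (simp only: sum.lessThan_Suc_shift sum_distrib_left) (simp add: mult_ac)
  show ?case
  proof (cases j)
    case 0
    then show ?thesis using c0 by (simp only: eq) simp
  next
    case (Suc i)
    have "(c 0 + x * r) div x ^ j = (c 0 + x * r) div x div x ^ i"
      using c0 Suc by (simp add: zdiv_zmult2_eq)
    also have "(c 0 + x * r) div x = r"
      using c0 by simp
    finally show ?thesis
      using Suc.IH[of "\<lambda>i. c (Suc i)" i] Suc.prems Suc by (simp only: eq) (simp add: r_def)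
  qed
qed

text \<open>All digits of \<open>x ^ s - 1\<close> equal \<open>x - 1\<close>, so the gap between
  the two sides is the digit sum of the deficits \<open>x - 1 - c i\<close>. These are nonnegative,
  and \<open>less\<close> makes their total positive; weighting them by \<open>x ^ i \<ge> 1\<close>
  cannot decrease it.\<close>

lemma digit_sum_less_power_minus_one:
  fixes c :: "nat \<Rightarrow> int"
  assumes digit: "\<And>i. i < s \<Longrightarrow> c i < x" and x: "x \<ge> 1"
    and less: "(\<Sum>i<s. c i) < int s * (x - 1)"
  shows "(\<Sum>i<s. c i * x ^ i) < x ^ s - 1"
proof -
  have "0 < (\<Sum>i<s. x - 1 - c i)"
    using less by (simp add: sum_subtractf)
  also have "\<dots> \<le> (\<Sum>i<s. (x - 1 - c i) * x ^ i)"
  proof (rule sum_mono)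
    fix i assume "i \<in> {..<s}"
    then have "0 \<le> x - 1 - c i" using digit[of i] by simp
    moreover have "1 \<le> x ^ i" using x by simp
    ultimately show "x - 1 - c i \<le> (x - 1 - c i) * x ^ i"
      using mult_left_mono[of 1 "x ^ i" "x - 1 - c i"] by simp
  qed
  also have "\<dots> = (x - 1) * (\<Sum>i<s. x ^ i) - (\<Sum>i<s. c i * x ^ i)"
    by (simp add: left_diff_distrib sum_subtractf sum_distrib_left)
  also have "(x - 1) * (\<Sum>i<s. x ^ i) = x ^ s - 1"
    by (rule power_diff_1_eq[symmetric])
  finally show ?thesis by simp
qed

text \<open>Split \<open>k\<close> as \<open>s * (k div s) + k mod s\<close> and use that
  \<open>x ^ s\<close> is congruent to 1.\<close>

lemma power_mod_power_minus_one:
  fixes x :: int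
  shows "x ^ k mod (x ^ s - 1) = x ^ (k mod s) mod (x ^ s - 1)"
proof -
  have "x ^ s mod (x ^ s - 1) = 1 mod (x ^ s - 1)"
    by (simp add: mod_eq_dvd_iff)
  then have "(x ^ s) ^ (k div s) mod (x ^ s - 1) = 1 ^ (k div s) mod (x ^ s - 1)"
    by (metis power_mod)
  then have "(x ^ s) ^ (k div s) * x ^ (k mod s) mod (x ^ s - 1) = 1 * x ^ (k mod s) mod (x ^ s - 1)"
    by (intro mod_mult_cong) simp_all
  then show ?thesis
    by (simp flip: power_mult power_add)
qed

definition residue_binomial_sum :: "nat \<Rightarrow> nat \<Rightarrow> nat \<Rightarrow> int" where
  "residue_binomial_sum n s j = (\<Sum>k | k \<le> n \<and> k mod s = j. int (n choose k))"

lemma residue_binomial_sum_nonneg: "0 \<le> residue_binomial_sum n s j"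
  by (simp add: residue_binomial_sum_def sum_nonneg)

lemma residue_binomial_sum_pos:
  assumes "j \<le> n" and "j < s"
  shows "0 < residue_binomial_sum n s j"
  unfolding residue_binomial_sum_def
  by (rule sum_pos2[of _ j]) (use assms in auto)

lemma sum_residue_classes:
  fixes f :: "nat \<Rightarrow> int"
  assumes "s > 0"
  shows "(\<Sum>j<s. \<Sum>k | k \<le> n \<and> k mod s = j. f k) = (\<Sum>k\<le>n. f k)"
  using sum.group[of "{..n}" "{..<s}" "\<lambda>k. k mod s" f] assms by (simp add: image_subset_iff)

lemma sum_residue_binomial_sum:
  assumes "s > 0"
  shows "(\<Sum>j<s. residue_binomial_sum n s j) = 2 ^ n"
proof -
  have "(\<Sum>j<s. residue_binomial_sum n s j) = int (\<Sum>k\<le>n. n choose k)"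
    using sum_residue_classes[OF assms] by (simp add: residue_binomial_sum_def)
  then show ?thesis by (simp add: choose_row_sum)
qed

lemma residue_binomial_sum_less:
  assumes "n \<ge> 1" "s \<ge> 2" "j < s"
  shows "residue_binomial_sum n s j < 2 ^ n"
proof -
  \<comment> \<open>A second residue class whose binomial sum is positive: 0 and 1 both lie below
    \<open>s\<close> and do not exceed \<open>n\<close>, and one of them differs from
    \<open>j\<close>.\<close>
  define i where "i = (if j = 0 then 1 else 0 :: nat)"
  have i: "i < s" "i \<le> n" "i \<noteq> j" using assms by (auto simp: i_def)
  have "residue_binomial_sum n s j < residue_binomial_sum n s i + residue_binomial_sum n s j"
    using residue_binomial_sum_pos i by simp
  also have "\<dots> = (\<Sum>k\<in>{i, j}. residue_binomial_sum n s k)"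
    using i by simp
  also have "\<dots> \<le> (\<Sum>k<s. residue_binomial_sum n s k)"
    by (rule sum_mono2) (use i assms residue_binomial_sum_nonneg in auto)
  finally show ?thesis
    using assms by (simp add: sum_residue_binomial_sum)
qed

lemma binomial_power_mod_power_minus_one:
  fixes x :: int
  assumes "s > 0"
  shows "(x + 1) ^ n mod (x ^ s - 1)
       = (\<Sum>j<s. residue_binomial_sum n s j * x ^ j) mod (x ^ s - 1)"
proof -
  have "(x + 1) ^ n mod (x ^ s - 1) = (\<Sum>k\<le>n. int (n choose k) * x ^ k) mod (x ^ s - 1)"
    by (simp add: binomial_ring)
  also have "\<dots> = (\<Sum>k\<le>n. int (n choose k) * x ^ k mod (x ^ s - 1)) mod (x ^ s - 1)"
    by (simp add: mod_sum_eq)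
  also have "\<dots> = (\<Sum>k\<le>n. int (n choose k) * x ^ (k mod s) mod (x ^ s - 1)) mod (x ^ s - 1)"
    by (intro arg_cong[of _ _ "\<lambda>t. t mod (x ^ s - 1)"] sum.cong mod_mult_cong refl
        power_mod_power_minus_one)
  also have "\<dots> = (\<Sum>k\<le>n. int (n choose k) * x ^ (k mod s)) mod (x ^ s - 1)"
    by (simp add: mod_sum_eq)
  also have "(\<Sum>k\<le>n. int (n choose k) * x ^ (k mod s))
      = (\<Sum>j<s. \<Sum>k | k \<le> n \<and> k mod s = j. int (n choose k) * x ^ (k mod s))"
    by (rule sum_residue_classes[OF assms, symmetric])
  \<comment> \<open>On each residue class the power \<open>x ^ (k mod s)\<close> is the constant
    \<open>x ^ j\<close> and factors out.\<close>
  also have "\<dots> = (\<Sum>j<s. residue_binomial_sum n s j * x ^ j)"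
    by (simp add: residue_binomial_sum_def sum_distrib_right)
  finally show ?thesis .
qed

lemma residue_binomial_sum_eq_arithmetic_progression:
  assumes "j < s"
  shows "(\<Sum>v = 0..\<lfloor>(real n - real j) / real s\<rfloor>. int (n choose (nat v * s + j)))
       = residue_binomial_sum n s j"
proof -
  \<comment> \<open>This also covers \<open>j > n\<close>: the floor is then negative, and both
    sides are false for every \<open>v \<ge> 0\<close>.\<close>
  have bound: "v \<le> \<lfloor>(real n - real j) / real s\<rfloor> \<longleftrightarrow> nat v * s + j \<le> n" if "0 \<le> v" for v
  proof -
    have "v \<le> \<lfloor>(real n - real j) / real s\<rfloor> \<longleftrightarrow> real (nat v) * real s + real j \<le> real n"
      using that assms by (simp add: le_floor_iff field_simps)
    also have "\<dots> \<longleftrightarrow> real (nat v * s + j) \<le> real n"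
      by simp
    finally show ?thesis by (simp only: of_nat_le_iff)
  qed
  show ?thesis
    unfolding residue_binomial_sum_def
  proof (rule sum.reindex_bij_witness[of _ "\<lambda>k. int (k div s)" "\<lambda>v. nat v * s + j"])
    fix k assume "k \<in> {k. k \<le> n \<and> k mod s = j}"
    then have "k div s * s + j = k" "k \<le> n" by auto
    then show "int (k div s) \<in> {0..\<lfloor>(real n - real j) / real s\<rfloor>}"
      and "nat (int (k div s)) * s + j = k"
      using bound[of "int (k div s)"] by auto
  qed (use assms bound in auto)
qed

theorem theorem4p1:
  fixes j n s :: nat
  assumes "n \<ge> 1" and "s \<ge> 2" and "j < s" and "(s - 1) * n \<ge> 2"
  shows "(\<Sum>v = 0..\<lfloor>(real n - real j) / real s\<rfloor>. int (n choose (nat v * s + j)))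
       = \<lfloor>real_of_int ((2 ^ n + 1) ^ n mod (2 ^ (n * s) - 1)) / 2 ^ (n * j)\<rfloor> mod 2 ^ n"
proof -
  define x :: int where "x = 2 ^ n"
  let ?c = "residue_binomial_sum n s"
  let ?N = "\<Sum>i<s. ?c i * x ^ i"
  have x2: "x \<ge> 2"
    using assms(1) power_increasing[of 1 n "2::int"] by (simp add: x_def)
  have digit: "0 \<le> ?c i \<and> ?c i < x" if "i < s" for i
    using residue_binomial_sum_nonneg residue_binomial_sum_less[OF assms(1,2) that]
    by (simp add: x_def)
  \<comment> \<open>The hypothesis \<open>(s - 1) * n \<ge> 2\<close> rules out
    \<open>s = 2\<close>, \<open>n = 1\<close>, where \<open>x = 2\<close> and equality would hold.
    So either \<open>s = 2\<close> and \<open>x \<ge> 4\<close>, or \<open>s \<ge> 3\<close> and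
    \<open>x \<ge> 2\<close> suffices.\<close>
  have "x < int s * (x - 1)"
  proof (cases "s = 2")
    case True
    then have "x \<ge> 4"
      using assms(4) power_increasing[of 2 n "2::int"] by (simp add: x_def)
    then show ?thesis using True by simp
  next
    case False
    then have "3 * (x - 1) \<le> int s * (x - 1)"
      using assms(2) x2 by (intro mult_right_mono) auto
    then show ?thesis using x2 by simp
  qed
  then have "?N < x ^ s - 1"
    using digit x2 assms(2) sum_residue_binomial_sum[of s n]
    by (intro digit_sum_less_power_minus_one) (auto simp: x_def)
  moreover have "0 \<le> ?N"
    using digit x2 by (intro sum_nonneg mult_nonneg_nonneg) auto
  \<comment> \<open>The digit sum lies in the range of remainders, so reducing it modulo
    \<open>x ^ s - 1\<close> leaves it unchanged.\<close>
  ultimately have "(x + 1) ^ n mod (x ^ s - 1) = ?N"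
    using assms(2) by (simp add: binomial_power_mod_power_minus_one)
  then have N: "(2 ^ n + 1) ^ n mod (2 ^ (n * s) - 1) = ?N"
    by (simp add: x_def power_mult)
  have "\<lfloor>real_of_int ?N / 2 ^ (n * j)\<rfloor> = ?N div x ^ j"
    using floor_divide_of_int_eq[of ?N "x ^ j", where ?'a = real] by (simp add: x_def power_mult)
  moreover have "?N div x ^ j mod x = ?c j"
    by (rule div_power_mod_digit_sum[OF digit assms(3)])
  ultimately have "\<lfloor>real_of_int ?N / 2 ^ (n * j)\<rfloor> mod 2 ^ n = ?c j"
    by (simp add: x_def)
  then show ?thesis
    by (simp only: N residue_binomial_sum_eq_arithmetic_progression[OF assms(3)])
qed

end
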